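(* Let $n\ge1$, let $p\in\mathbb{R}\cup\{\pm\infty\}$, let $\lambda\in(0,1)$, and let $f,g:\mathbb{R}^n\to\mathbb{R}_{\geq0}\cup\{\infty\}$ be non-negative measurable functions (finite-valued when $p=0$) such that $(1-\lambda) f\star_p\lambda g$ is measurable. If there exists a hyperplane $H\in\mathcal{L}^n_{n-1}$ such that $$\mathrm{proj}_H(f)=\mathrm{proj}_H(g),$$ then $$\int_{\mathbb{R}^n}(1-\lambda) f\star_p\lambda g\,\mathrm{d} x \;\geq\; (1-\lambda)\int_{\mathbb{R}^n}f\,\mathrm{d} x +\lambda\int_{\mathbb{R}^n}g\,\mathrm{d} x.$$
   Context: Measurable means Lebesgue measurable; integrals of non-negative functions take values in $[0,\infty]$. $\mathcal{L}^n_{n-1}$ is the set of $(n-1)$-dimensional linear subspaces of $\mathbb{R}^n$. $p$-th means: for $a,b\ge0$ and $\lambda\in(0,1)$, if $a=0$ or $b=0$ then $M_p(a,b,\lambda)=0$ for every $p\in\mathbb{R}\cup\{\pm\infty\}$. For $a,b>0$: $M_p(a,b,\lambda)=((1-\lambda)a^p+\lambda b^p)^{1/p}$ if $p\in\mathbb{R}\setminus\{0\}$; $M_0(a,b,\lambda)=a^{1-\lambda}b^{\lambda}$; $M_\infty(a,b,\lambda)=\max\{a,b\}$; $M_{-\infty}(a,b,\lambda)=\min\{a,b\}$. For $p\ne0$ the values $a=\infty$ or $b=\infty$ (the other being positive) are allowed, and $M_p$ is then defined by continuity (e.g. $M_p(a,\infty,\lambda)=\infty$ for $0<p\le\infty$,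 and $M_p(a,\infty,\lambda)=(1-\lambda)^{1/p}a$ for $-\infty<p<0$, $0<a<\infty$). For non-negative (extended, if $p\ne0$) functions $f,g$ on $\mathbb{R}^n$, $$\bigl((1-\lambda)f\star_p\lambda g\bigr)(x)=\sup_{(1-\lambda)x_1+\lambda x_2=x}M_p(f(x_1),g(x_2),\lambda).$$ For $f:\mathbb{R}^n\to\mathbb{R}_{\ge0}\cup\{\infty\}$ and $H\in\mathcal{L}^n_{n-1}$ with unit normal vector $\nu$, $\mathrm{proj}_H(f):H\to\mathbb{R}_{\ge0}\cup\{\infty\}$ is defined by $\mathrm{proj}_H(f)(h)=\sup_{\alpha\in\mathbb{R}} f(h+\alpha\nu)$. *)

theory Defs
  imports "HOL-Analysis.Analysis"
begin

text \<open>
  The mean \<open>M\<^sub>p(a, b, lam)\<close>.  For a finite exponent other than 0, the values at \<open>a = top\<close> or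
  \<open>b = top\<close> are the limits from finite positive arguments.  The mean of exponent 0 is only meant
  for finite arguments; its value \<open>top\<close> at infinite ones is a dummy.
\<close>

definition p_mean :: "ereal \<Rightarrow> ennreal \<Rightarrow> ennreal \<Rightarrow> real \<Rightarrow> ennreal" where
  "p_mean p a b lam =
    (if a = 0 \<or> b = 0 then 0
     else case p of
       PInfty \<Rightarrow> max a b
     | MInfty \<Rightarrow> min a b
     | ereal r \<Rightarrow>
         if a < top \<and> b < top then
           (if r = 0 then ennreal (enn2real a powr (1 - lam) * enn2real b powr lam)
            else ennreal (((1 - lam) * enn2real a powr r + lam * enn2real b powr r) powr (1 / r)))
         else if r \<ge> 0 then top
         else if a < top then ennreal ((1 - lam) powr (1 / r)) * a
         else if b < top then ennreal (lam powr (1 / r)) * b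
         else top)"

definition sup_conv ::
    "ereal \<Rightarrow> real \<Rightarrow> (real ^ 'n \<Rightarrow> ennreal) \<Rightarrow> (real ^ 'n \<Rightarrow> ennreal) \<Rightarrow> real ^ 'n \<Rightarrow> ennreal" where
  "sup_conv p lam f g x =
    (SUP (x1, x2) \<in> {(x1, x2). (1 - lam) *\<^sub>R x1 + lam *\<^sub>R x2 = x}. p_mean p (f x1) (g x2) lam)"

definition is_unit_normal :: "(real ^ 'n) set \<Rightarrow> real ^ 'n \<Rightarrow> bool" where
  "is_unit_normal H \<nu> \<longleftrightarrow> norm \<nu> = 1 \<and> (\<forall>h\<in>H. h \<bullet> \<nu> = 0)"

text \<open>
  The projection is a function with domain \<open>H\<close> (an extensional function).  It does not depend on
  which of the two unit normals is chosen, see \<open>proj_eq\<close> below.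
\<close>

definition proj :: "(real ^ 'n) set \<Rightarrow> (real ^ 'n \<Rightarrow> ennreal) \<Rightarrow> real ^ 'n \<Rightarrow> ennreal" where
  "proj H f = (\<lambda>h\<in>H. SUP \<alpha>::real. f (h + \<alpha> *\<^sub>R (SOME \<nu>. is_unit_normal H \<nu>)))"

definition hyperplanes :: "(real ^ 'n) set set" where
  "hyperplanes = {H. subspace H \<and> dim H = CARD('n) - 1}"

lemma ex_unit_normal:
  fixes H :: "(real ^ 'n) set"
  assumes "H \<in> hyperplanes"
  shows "\<exists>\<nu>. is_unit_normal H \<nu>"
proof -
  have "dim H < DIM(real ^ 'n)"
    using assms by (simp add: hyperplanes_def)
  then obtain x where x: "x \<noteq> 0" "\<And>y. y \<in> span H \<Longrightarrow> orthogonal x y"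
    using orthogonal_to_subspace_exists by blast
  have "is_unit_normal H (x /\<^sub>R norm x)"
    using x by (auto simp: is_unit_normal_def orthogonal_def span_base inner_commute)
  then show ?thesis by blast
qed

lemma unit_normal_unique:
  fixes H :: "(real ^ 'n) set"
  assumes H: "H \<in> hyperplanes" and \<mu>: "is_unit_normal H \<mu>" and \<nu>: "is_unit_normal H \<nu>"
  shows "\<mu> = \<nu> \<or> \<mu> = - \<nu>"
proof -
  have H': "subspace H" "dim H = CARD('n) - 1"
    using H by (auto simp: hyperplanes_def)
  have n0: "\<nu> \<noteq> 0" using \<nu> by (auto simp: is_unit_normal_def)
  have sub: "H \<subseteq> {x. \<nu> \<bullet> x = 0}"
    using \<nu> by (auto simp: is_unit_normal_def inner_commute)
  have "H = {x. \<nu> \<bullet> x = 0}"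
    by (rule subspace_dim_equal[OF H'(1) subspace_hyperplane sub])
       (use n0 H'(2) in \<open>simp add: dim_hyperplane\<close>)
  moreover have "\<nu> \<bullet> (\<mu> - (\<nu> \<bullet> \<mu>) *\<^sub>R \<nu>) = 0"
    using \<nu> by (simp add: is_unit_normal_def inner_diff_right dot_square_norm)
  ultimately have "\<mu> - (\<nu> \<bullet> \<mu>) *\<^sub>R \<nu> \<in> H" by simp
  then have "(\<mu> - (\<nu> \<bullet> \<mu>) *\<^sub>R \<nu>) \<bullet> (\<mu> - (\<nu> \<bullet> \<mu>) *\<^sub>R \<nu>) = 0"
    using \<mu> \<nu> by (simp add: is_unit_normal_def inner_diff_right)
  then have eq: "\<mu> = (\<nu> \<bullet> \<mu>) *\<^sub>R \<nu>" by simp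
  then have "\<bar>\<nu> \<bullet> \<mu>\<bar> = 1"
    using \<mu> \<nu> unfolding is_unit_normal_def by (metis mult.right_neutral norm_scaleR)
  then show ?thesis using eq by (metis abs_eq_iff' abs_one scaleR_minus1_left scaleR_one)
qed

lemma proj_eq:
  fixes H :: "(real ^ 'n) set"
  assumes H: "H \<in> hyperplanes" and \<nu>: "is_unit_normal H \<nu>" and h: "h \<in> H"
  shows "proj H f h = (SUP \<alpha>::real. f (h + \<alpha> *\<^sub>R \<nu>))"
proof -
  let ?\<mu> = "SOME \<nu>. is_unit_normal H \<nu>"
  have "?\<mu> = \<nu> \<or> ?\<mu> = - \<nu>"
    using unit_normal_unique[OF H someI_ex[OF ex_unit_normal[OF H]] \<nu>] .
  moreover have "(SUP \<alpha>::real. f (h + \<alpha> *\<^sub>R (- \<nu>))) = (SUP \<alpha>::real. f (h + \<alpha> *\<^sub>R \<nu>))"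
    by (rule SUP_eq) (metis UNIV_I minus_minus order_refl scaleR_minus_left scaleR_minus_right)+
  ultimately have "(SUP \<alpha>::real. f (h + \<alpha> *\<^sub>R ?\<mu>)) = (SUP \<alpha>::real. f (h + \<alpha> *\<^sub>R \<nu>))"
    by metis
  then show ?thesis
    using h by (simp add: proj_def)
qed

end

theory Submission imports Defs begin

text \<open>
  Since every mean dominates the minimum, it suffices to treat \<open>p = -\<infinity>\<close>, where the superlevel sets
  of the convolution contain the combinations of the superlevel sets of \<open>f\<close> and \<open>g\<close>.  On every
  line orthogonal to \<open>H\<close> the functions \<open>f\<close> and \<open>g\<close> have the same supremum, so that at each
  height their superlevel sets are both empty or both nonempty.  The Brunn-Minkowski inequality on
  the line together with the layer cake formula then gives the inequality on that line, and
  integration over all the lines completes the proof.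
\<close>

section \<open>Measure-theoretic preliminaries: completions and the layer cake formula\<close>

text \<open>The layer cake formula rests on Fubini and will be applied to Lebesgue measure on a
  line, which is the completion of \<open>lborel\<close>.\<close>

lemma sigma_finite_completion:
  assumes "sigma_finite_measure M"
  shows "sigma_finite_measure (completion M)"
proof -
  obtain A where "countable A" "A \<subseteq> sets M" "\<Union>A = space M" "\<And>a. a \<in> A \<Longrightarrow> emeasure M a \<noteq> \<infinity>"
    using sigma_finite_measure.sigma_finite_countable[OF assms] by blast
  then show ?thesis
    by (intro sigma_finite_measure.intro exI[of _ A])
       (auto simp: emeasure_completion main_part_sets subset_iff)
qed

text \<open>Preimages under \<open>f\<close> and \<open>g\<close> differ by a subset of a null set,
  and the completion contains all such subsets. This will make the restrictions of \<open>f\<close>,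
  \<open>g\<close> and the convolution to almost every line measurable.\<close>

lemma borel_measurable_completion_AE:
  assumes g [measurable]: "g \<in> borel_measurable M" and ae: "AE x in M. f x = g x"
  shows "f \<in> borel_measurable (completion M)"
proof (rule measurableI)
  fix B :: "'b set" assume [measurable]: "B \<in> sets borel"
  have "AE x in completion M. x \<in> g -` B \<inter> space M \<longleftrightarrow> x \<in> f -` B \<inter> space M"
    using ae by (intro AE_completion) auto
  moreover have "g -` B \<inter> space M \<in> sets (completion M)"
    by (intro sets_completionI_sets) measurable
  ultimately have "f -` B \<inter> space M \<in> sets (completion M)"
    by (rule completion.in_sets_AE) simp
  then show "f -` B \<inter> space (completion M) \<in> sets (completion M)" by simp
qed auto

lemma emeasure_lborel_atLeast: "emeasure lborel {a::real..} = top"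
proof -
  have "of_nat n \<le> emeasure lborel {a..}" for n :: nat
    using emeasure_mono[of "{a..a + real n}" "{a..}" lborel]
    by (auto simp: ennreal_of_nat_eq_real_of_nat)
  then have "(SUP n::nat. of_nat n) \<le> emeasure lborel {a..}"
    by (rule SUP_least)
  then show ?thesis
    by (simp add: ennreal_SUP_of_nat_eq_top top_unique)
qed

text \<open>Both sides measure the region under the graph of \<open>f\<close>: Fubini exchanges
  slicing it over points \<open>x\<close> with slicing it at heights \<open>t\<close>.\<close>

lemma nn_integral_layer_cake:
  fixes f :: "'a \<Rightarrow> ennreal"
  assumes M: "sigma_finite_measure M" and f [measurable]: "f \<in> borel_measurable M"
  shows "(\<integral>\<^sup>+x. f x \<partial>M)
    = (\<integral>\<^sup>+t. emeasure M {x \<in> space M. 0 \<le> t \<and> ennreal t < f x} \<partial>lborel)"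
proof -
  interpret M: sigma_finite_measure M by (rule M)
  interpret P: pair_sigma_finite M lborel ..
  \<comment> \<open>The slice over a point is \<open>{0..<r}\<close>, or \<open>{0..}\<close> for
    the value \<open>top\<close>. The condition \<open>0 \<le> t\<close> matters because
    \<open>ennreal\<close> sends negative reals to 0, so that all negative \<open>t\<close> would
    count whenever \<open>c > 0\<close>.\<close>
  have len: "(\<integral>\<^sup>+t. indicator {t. 0 \<le> t \<and> ennreal t < c} t \<partial>lborel) = c" for c
  proof (cases c)
    case (real r)
    then have "{t. 0 \<le> t \<and> ennreal t < c} = {0..<r}"
      by (auto simp: ennreal_less_iff)
    then show ?thesis using real by simp
  next
    case top
    then have "{t. 0 \<le> t \<and> ennreal t < c} = {0..}"
      by auto
    then show ?thesis using top by (simp add: emeasure_lborel_atLeast)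
  qed
  have "(\<integral>\<^sup>+x. f x \<partial>M)
      = (\<integral>\<^sup>+x. \<integral>\<^sup>+t. indicator {t. 0 \<le> t \<and> ennreal t < f x} t \<partial>lborel \<partial>M)"
    by (simp only: len)
  also have "\<dots> = (\<integral>\<^sup>+t. \<integral>\<^sup>+x. indicator {t. 0 \<le> t \<and> ennreal t < f x} t \<partial>M \<partial>lborel)"
    by (rule P.Fubini'[symmetric]) (simp add: indicator_def)
  also have "\<dots> = (\<integral>\<^sup>+t. emeasure M {x \<in> space M. 0 \<le> t \<and> ennreal t < f x} \<partial>lborel)"
  proof (rule nn_integral_cong)
    fix t :: real
    have "(\<integral>\<^sup>+x. indicator {t. 0 \<le> t \<and> ennreal t < f x} t \<partial>M)
        = (\<integral>\<^sup>+x. indicator {x \<in> space M. 0 \<le> t \<and> ennreal t < f x} x \<partial>M)"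
      by (intro nn_integral_cong) (auto simp: indicator_def)
    also have "\<dots> = emeasure M {x \<in> space M. 0 \<le> t \<and> ennreal t < f x}"
      by (rule nn_integral_indicator) measurable
    finally show "(\<integral>\<^sup>+x. indicator {t. 0 \<le> t \<and> ennreal t < f x} t \<partial>M)
        = emeasure M {x \<in> space M. 0 \<le> t \<and> ennreal t < f x}" .
  qed
  finally show ?thesis .
qed

lemma affine_image_in_sets_lebesgue:
  fixes S :: "'a::euclidean_space set"
  assumes "S \<in> sets lebesgue"
  shows "(\<lambda>x. m *\<^sub>R x + d) ` S \<in> sets lebesgue"
  by (rule differentiable_image_in_sets_lebesgue[OF assms]) (auto intro!: derivative_intros)

section \<open>Comparison of the means with the minimum\<close>

text \<open>For finite positive arguments, the mean is monotone in both of them and the mean of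
  \<open>m\<close> with itself is \<open>m\<close>; take \<open>m\<close> to be the minimum. Zero
  and infinite arguments are checked from the definition.\<close>

lemma p_mean_ge_min:
  assumes lam: "0 < lam" "lam < 1"
  shows "min a b \<le> p_mean p a b lam"
proof (cases "a = 0 \<or> b = 0")
  case True
  then show ?thesis by (auto simp: p_mean_def min_def)
next
  case nz: False
  have one_le: "1 \<le> s powr (1 / r)" if "0 < s" "s < 1" "r < 0" for s r :: real
    using powr_mono2'[of "1 / r" s 1] that by simp
  show ?thesis
  proof (cases p)
    case (real r)
    show ?thesis
    proof (cases "a < top \<and> b < top")
      case True
      define x where "x = enn2real a"
      define y where "y = enn2real b"
      define m where "m = min x y"
      have pos: "0 < x" "0 < y" and ab: "a = ennreal x" "b = ennreal y"
        using True nz by (auto simp: x_def y_def enn2real_positive_iff zero_less_iff_neq_zero)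
      have m: "0 < m" "m \<le> x" "m \<le> y" and mab: "min a b = ennreal m"
        using pos by (auto simp: m_def ab min_def)
      have mean: "p_mean p a b lam = (if r = 0 then ennreal (x powr (1 - lam) * y powr lam)
          else ennreal (((1 - lam) * x powr r + lam * y powr r) powr (1 / r)))"
        using True nz real by (simp add: p_mean_def x_def y_def)
      consider "r = 0" | "0 < r" | "r < 0" by linarith
      then show ?thesis
      proof cases
        case 1
        have "m = m powr (1 - lam) * m powr lam"
          using m by (simp flip: powr_add)
        also have "\<dots> \<le> x powr (1 - lam) * y powr lam"
          using m lam pos by (intro mult_mono powr_mono2) auto
        finally show ?thesis
          using 1 by (simp add: mean mab ennreal_leI)
      next
        case 2
        have "m = ((1 - lam) * m powr r + lam * m powr r) powr (1 / r)"
          using m 2 by (simp add: powr_powr flip: distrib_right)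
        also have "\<dots> \<le> ((1 - lam) * x powr r + lam * y powr r) powr (1 / r)"
          using m lam pos 2 by (intro add_mono mult_mono powr_mono2) auto
        finally show ?thesis
          using 2 by (simp add: mean mab ennreal_leI)
      next
        case 3
        have "m = ((1 - lam) * m powr r + lam * m powr r) powr (1 / r)"
          using m 3 by (simp add: powr_powr flip: distrib_right)
        \<comment> \<open>For \<open>r < 0\<close> the inner powers reverse the order and the outer
          power \<open>1 / r\<close> reverses it again.\<close>
        also have "\<dots> \<le> ((1 - lam) * x powr r + lam * y powr r) powr (1 / r)"
          using m lam pos 3
          by (intro powr_mono2' add_mono mult_mono) (auto intro!: add_pos_pos)
        finally show ?thesis
          using 3 by (simp add: mean mab ennreal_leI)
      qed
    next
      case False
      \<comment> \<open>With one infinite argument and \<open>r < 0\<close>, the mean is the finite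
        argument times a weight in (0,1) raised to a negative power, and such a factor is at least
        1.\<close>
      have grow: "c \<le> ennreal (s powr (1 / r)) * c" if "0 < s" "s < 1" "r < 0" for s c
        using mult_right_mono[of 1 "ennreal (s powr (1 / r))" c] one_le[OF that] by simp
      show ?thesis
        using False nz real lam grow[of "1 - lam" a] grow[of lam b]
        by (auto simp: p_mean_def less_top min_def not_less top_unique)
    qed
  qed (use nz in \<open>auto simp: p_mean_def min_def\<close>)
qed


section \<open>The Brunn-Minkowski inequality on the real line\<close>

text \<open>Truncating \<open>A\<close> below points of \<open>A\<close> that increase to its
  supremum loses at most the supremum itself, which is a null set. This replaces an approximation by
  compact sets, where a maximum would be available.\<close>

lemma emeasure_eq_SUP_lessThan:
  fixes A :: "real set"
  assumes A [measurable]: "A \<in> sets lebesgue" and ne: "A \<noteq> {}"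
  shows "emeasure lebesgue A = (SUP a\<in>A. emeasure lebesgue (A \<inter> {..<a}))"
proof (rule antisym)
  have [measurable]: "(\<lambda>x::real. x) \<in> borel_measurable lebesgue"
    by (simp add: measurable_completion)
  \<comment> \<open>A sequence is needed for continuity of the measure from below; taking the
    supremum in \<open>ereal\<close> covers sets that are unbounded above.\<close>
  obtain s where s: "incseq s" "range s \<subseteq> ereal ` A" "Sup (ereal ` A) = (SUP n. s n)"
    using Sup_countable_SUP[of "ereal ` A"] ne by auto
  from s(2) have "\<forall>n. \<exists>a\<in>A. s n = ereal a" by blast
  then obtain \<sigma> where \<sigma>: "\<And>n. \<sigma> n \<in> A" "\<And>n. s n = ereal (\<sigma> n)" by metis
  have "incseq \<sigma>" using s(1) by (simp add: incseq_def \<sigma>)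
  then have inc: "incseq (\<lambda>n. A \<inter> {..<\<sigma> n})"
    by (fastforce simp: incseq_def)
  define U where "U = (\<Union>n. A \<inter> {..<\<sigma> n})"
  have U [measurable]: "U \<in> sets lebesgue" unfolding U_def by measurable
  \<comment> \<open>A point of \<open>A\<close> outside \<open>U\<close> is an upper bound of the
    sequence and hence equals the supremum. If the supremum is infinite there is no such point, and
    the singleton is merely a harmless null set.\<close>
  have "A \<subseteq> U \<union> {real_of_ereal (Sup (ereal ` A))}"
  proof
    fix x assume x: "x \<in> A"
    show "x \<in> U \<union> {real_of_ereal (Sup (ereal ` A))}"
    proof (cases "x \<in> U")
      case False
      then have "\<sigma> n \<le> x" for n using x by (auto simp: U_def not_less)
      then have "Sup (ereal ` A) \<le> ereal x" unfolding s(3) by (auto intro: SUP_least simp: \<sigma>)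
      moreover have "ereal x \<le> Sup (ereal ` A)" using x by (intro Sup_upper) auto
      ultimately have "Sup (ereal ` A) = ereal x" by (rule antisym)
      then show ?thesis by simp
    qed simp
  qed
  then have "emeasure lebesgue A \<le> emeasure lebesgue (U \<union> {real_of_ereal (Sup (ereal ` A))})"
    by (rule emeasure_mono) (rule sets.Un[OF U], simp)
  also have "\<dots> \<le> emeasure lebesgue U + emeasure lebesgue {real_of_ereal (Sup (ereal ` A))}"
    by (rule emeasure_subadditive) auto
  also have "\<dots> = emeasure lebesgue U" by simp
  also have "\<dots> = (SUP n. emeasure lebesgue (A \<inter> {..<\<sigma> n}))"
    unfolding U_def by (rule SUP_emeasure_incseq[symmetric, OF _ inc]) auto
  also have "\<dots> \<le> (SUP a\<in>A. emeasure lebesgue (A \<inter> {..<a}))"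
    using \<sigma>(1) by (intro SUP_mono) auto
  finally show "emeasure lebesgue A \<le> (SUP a\<in>A. emeasure lebesgue (A \<inter> {..<a}))" .
qed (auto intro!: SUP_least emeasure_mono simp del: emeasure_completion)

text \<open>Reflection at 0 preserves Lebesgue measure and turns this into the previous
  lemma.\<close>

lemma emeasure_eq_SUP_greaterThan:
  fixes A :: "real set"
  assumes A: "A \<in> sets lebesgue" and ne: "A \<noteq> {}"
  shows "emeasure lebesgue A = (SUP a\<in>A. emeasure lebesgue (A \<inter> {a<..}))"
proof -
  have neg: "emeasure lebesgue (uminus ` S) = emeasure lebesgue S" for S :: "real set"
    using emeasure_lebesgue_affine[of "-1" 0 S] by simp
  have "uminus ` A \<in> sets lebesgue"
    using affine_image_in_sets_lebesgue[OF A, of "-1" 0] by simp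
  then have "emeasure lebesgue A = (SUP a\<in>uminus ` A. emeasure lebesgue (uminus ` A \<inter> {..<a}))"
    using emeasure_eq_SUP_lessThan[of "uminus ` A"] ne by (simp add: neg del: emeasure_completion)
  also have "\<dots> = (SUP a\<in>A. emeasure lebesgue (uminus ` A \<inter> {..< - a}))"
    by (simp add: image_image del: emeasure_completion)
  also have "\<dots> = (SUP a\<in>A. emeasure lebesgue (uminus ` (A \<inter> {a<..})))"
    by (rule SUP_cong[OF refl], rule arg_cong[where f = "emeasure lebesgue"]) force
  finally show ?thesis by (simp add: neg del: emeasure_completion)
qed

text \<open>Fix \<open>a\<close> in \<open>A\<close> and \<open>b\<close> in \<open>B\<close>.
  Combining the part of \<open>A\<close> below \<open>a\<close> with the point \<open>b\<close>, and
  the part of \<open>B\<close> above \<open>b\<close> with the point \<open>a\<close>, gives two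
  disjoint scaled copies inside \<open>C\<close>. Their measures add up, and the supremum over
  \<open>a\<close> and \<open>b\<close> recovers all of \<open>A\<close> and \<open>B\<close>. The
  measurable set \<open>C\<close> stands in for the combination of \<open>A\<close> and
  \<open>B\<close>, which may fail to be measurable.\<close>

lemma brunn_minkowski_real:
  fixes A B C :: "real set"
  assumes lam: "0 < lam" "lam < 1"
    and A [measurable]: "A \<in> sets lebesgue" and B [measurable]: "B \<in> sets lebesgue"
    and C: "C \<in> sets lebesgue" and ne: "A \<noteq> {}" "B \<noteq> {}"
    and sub: "\<And>a b. a \<in> A \<Longrightarrow> b \<in> B \<Longrightarrow> (1 - lam) * a + lam * b \<in> C"
  shows "ennreal (1 - lam) * emeasure lebesgue A + ennreal lam * emeasure lebesgue B
    \<le> emeasure lebesgue C"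
proof -
  define \<alpha> where "\<alpha> a = ennreal (1 - lam) * emeasure lebesgue (A \<inter> {..<a})" for a
  define \<beta> where "\<beta> b = ennreal lam * emeasure lebesgue (B \<inter> {b<..})" for b
  have le: "\<alpha> a + \<beta> b \<le> emeasure lebesgue C" if a: "a \<in> A" and b: "b \<in> B" for a b
  proof -
    have [measurable]: "(\<lambda>x::real. x) \<in> borel_measurable lebesgue"
      by (simp add: measurable_completion)
    \<comment> \<open>The point \<open>(1 - lam) * a + lam * b\<close> separates these two subsets of \<open>C\<close>.\<close>
    let ?A = "(\<lambda>x. (1 - lam) *\<^sub>R x + lam * b) ` (A \<inter> {..<a})"
    let ?B = "(\<lambda>x. lam *\<^sub>R x + (1 - lam) * a) ` (B \<inter> {b<..})"
    have meas: "?A \<in> sets lebesgue" "?B \<in> sets lebesgue"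
      by (intro affine_image_in_sets_lebesgue; measurable)+
    have "x < (1 - lam) * a + lam * b" if "x \<in> ?A" for x
      using that lam by auto
    moreover have "(1 - lam) * a + lam * b < x" if "x \<in> ?B" for x
      using that lam by auto
    ultimately have disj: "?A \<inter> ?B = {}" by (meson disjoint_iff less_asym)
    have "?A \<union> ?B \<subseteq> C"
      using a b sub by (auto simp: add.commute)
    have "\<alpha> a + \<beta> b = emeasure lebesgue ?A + emeasure lebesgue ?B"
      using lam by (simp only: emeasure_lebesgue_affine) (simp add: \<alpha>_def \<beta>_def)
    also have "\<dots> = emeasure lebesgue (?A \<union> ?B)"
      by (rule plus_emeasure[OF meas disj])
    also have "\<dots> \<le> emeasure lebesgue C"
      by (rule emeasure_mono[OF \<open>?A \<union> ?B \<subseteq> C\<close> C])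
    finally show ?thesis .
  qed
  have "ennreal (1 - lam) * emeasure lebesgue A = (SUP a\<in>A. \<alpha> a)"
    unfolding \<alpha>_def emeasure_eq_SUP_lessThan[OF A ne(1)] by (rule SUP_mult_left_ennreal)
  moreover have "ennreal lam * emeasure lebesgue B = (SUP b\<in>B. \<beta> b)"
    unfolding \<beta>_def emeasure_eq_SUP_greaterThan[OF B ne(2)] by (rule SUP_mult_left_ennreal)
  \<comment> \<open>Moving a summand into a supremum requires a nonempty index set, which
    \<open>ne\<close> provides.\<close>
  moreover have "(SUP a\<in>A. \<alpha> a) + (SUP b\<in>B. \<beta> b) = (SUP a\<in>A. SUP b\<in>B. \<alpha> a + \<beta> b)"
    by (simp only: ennreal_SUP_add_right[symmetric, OF ne(2)] ennreal_SUP_add_left[OF ne(1)])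
  ultimately show ?thesis
    using le by (auto intro!: SUP_least simp del: emeasure_completion)
qed

section \<open>The integral inequality on a line\<close>

lemma min_convolution_real:
  fixes f g h :: "real \<Rightarrow> ennreal"
  assumes lam: "0 < lam" "lam < 1"
    and [measurable]: "f \<in> borel_measurable lebesgue" "g \<in> borel_measurable lebesgue"
      "h \<in> borel_measurable lebesgue"
    and sup: "(SUP x. f x) = (SUP x. g x)"
    and h: "\<And>a b. min (f a) (g b) \<le> h ((1 - lam) * a + lam * b)"
  shows "ennreal (1 - lam) * (\<integral>\<^sup>+x. f x \<partial>lebesgue) + ennreal lam * (\<integral>\<^sup>+x. g x \<partial>lebesgue)
    \<le> (\<integral>\<^sup>+x. h x \<partial>lebesgue)"
proof -
  define L where "L u t = {x \<in> space lebesgue. 0 \<le> t \<and> ennreal t < u x}" for u :: "real \<Rightarrow> ennreal" and t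
  interpret sigma_finite_measure "lebesgue :: real measure"
    by (rule sigma_finite_completion[OF sigma_finite_lborel])
  have [measurable]: "L u t \<in> sets lebesgue" if [measurable]: "u \<in> borel_measurable lebesgue" for u t
    unfolding L_def by measurable
  have [measurable]: "(\<lambda>t. emeasure lebesgue (L u t)) \<in> borel_measurable lborel"
    if [measurable]: "u \<in> borel_measurable lebesgue" for u
    unfolding L_def by measurable
  have cake: "(\<integral>\<^sup>+x. u x \<partial>lebesgue) = (\<integral>\<^sup>+t. emeasure lebesgue (L u t) \<partial>lborel)"
    if "u \<in> borel_measurable lebesgue" for u
    unfolding L_def by (rule nn_integral_layer_cake[OF _ that]) (rule sigma_finite_measure_axioms)
  have "ennreal (1 - lam) * (\<integral>\<^sup>+x. f x \<partial>lebesgue) + ennreal lam * (\<integral>\<^sup>+x. g x \<partial>lebesgue)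
      = (\<integral>\<^sup>+t. ennreal (1 - lam) * emeasure lebesgue (L f t)
          + ennreal lam * emeasure lebesgue (L g t) \<partial>lborel)"
    by (simp add: cake nn_integral_add nn_integral_cmult del: emeasure_completion)
  also have "\<dots> \<le> (\<integral>\<^sup>+t. emeasure lebesgue (L h t) \<partial>lborel)"
  proof (rule nn_integral_mono)
    fix t :: real
    \<comment> \<open>Whether a superlevel set is empty depends on \<open>u\<close> only through its
      supremum. This is where the equal suprema of \<open>f\<close> and \<open>g\<close> enter:
      Brunn-Minkowski fails if exactly one of the sets is empty.\<close>
    have empty_iff: "L u t = {} \<longleftrightarrow> \<not> (0 \<le> t \<and> ennreal t < (SUP x. u x))" for u
      by (auto simp: L_def less_SUP_iff)
    show "ennreal (1 - lam) * emeasure lebesgue (L f t) + ennreal lam * emeasure lebesgue (L g t)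
        \<le> emeasure lebesgue (L h t)"
    proof (cases "L f t = {}")
      case True
      then have "L g t = {}" using sup by (simp add: empty_iff)
      with True show ?thesis by simp
    next
      case False
      then have "L g t \<noteq> {}" using sup by (simp add: empty_iff)
      \<comment> \<open>If both values exceed \<open>t\<close>, so does their minimum, and therefore
        \<open>h\<close> at the combined point.\<close>
      moreover have "(1 - lam) * a + lam * b \<in> L h t" if "a \<in> L f t" "b \<in> L g t" for a b
        using that h[of a b] by (auto simp: L_def min_le_iff_disj)
      ultimately show ?thesis
        using False lam by (intro brunn_minkowski_real) auto
    qed
  qed
  also have "\<dots> = (\<integral>\<^sup>+x. h x \<partial>lebesgue)" by (simp add: cake)
  finally show ?thesis .
qed


section \<open>Fubini's theorem along a direction\<close>

text \<open>
  Integrating over a slab of width 1 in place of the hyperplane orthogonal to \<open>\<nu>\<close>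
  allows for the use of Fubini's theorem without a choice of coordinates.
\<close>

lemma nn_integral_slab:
  fixes F :: "'a::euclidean_space \<Rightarrow> ennreal" and \<nu> :: 'a
  assumes F [measurable]: "F \<in> borel_measurable borel" and \<nu>: "norm \<nu> = 1"
  shows "(\<integral>\<^sup>+x. F x \<partial>lborel)
    = (\<integral>\<^sup>+x. indicator {x. 0 \<le> x \<bullet> \<nu> \<and> x \<bullet> \<nu> < 1} x
        * (\<integral>\<^sup>+\<alpha>. F (x + \<alpha> *\<^sub>R \<nu>) \<partial>lborel) \<partial>lborel)"
proof -
  define S where "S = {x. 0 \<le> x \<bullet> \<nu> \<and> x \<bullet> \<nu> < 1}"
  have [measurable]: "S \<in> sets borel" unfolding S_def by measurable
  have \<nu>\<nu>: "\<nu> \<bullet> \<nu> = 1" using \<nu> by (simp add: dot_square_norm)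
  \<comment> \<open>Every line in direction \<nu> meets the slab in a half-open segment of length 1,
    so the slab weights each point of the space by exactly 1.\<close>
  have len: "(\<integral>\<^sup>+\<alpha>. indicator S (x - \<alpha> *\<^sub>R \<nu>) \<partial>lborel) = 1" for x
  proof -
    have "(\<integral>\<^sup>+\<alpha>. indicator S (x - \<alpha> *\<^sub>R \<nu>) \<partial>lborel)
        = (\<integral>\<^sup>+\<alpha>. indicator {x \<bullet> \<nu> - 1 <.. x \<bullet> \<nu>} \<alpha> \<partial>lborel)"
      by (intro nn_integral_cong) (auto simp: indicator_def S_def inner_diff_left \<nu>\<nu>)
    then show ?thesis by simp
  qed
  have "(\<integral>\<^sup>+x. indicator S x * (\<integral>\<^sup>+\<alpha>. F (x + \<alpha> *\<^sub>R \<nu>) \<partial>lborel) \<partial>lborel)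
      = (\<integral>\<^sup>+x. \<integral>\<^sup>+\<alpha>. indicator S x * F (x + \<alpha> *\<^sub>R \<nu>) \<partial>lborel \<partial>lborel)"
    by (simp add: nn_integral_cmult)
  also have "\<dots> = (\<integral>\<^sup>+\<alpha>. \<integral>\<^sup>+x. indicator S x * F (x + \<alpha> *\<^sub>R \<nu>) \<partial>lborel \<partial>lborel)"
    by (rule lborel_pair.Fubini'[symmetric]) measurable
  \<comment> \<open>For fixed \<alpha>, substitute \<open>x - \<alpha> *\<^sub>R \<nu>\<close> for
    \<open>x\<close> by translation invariance; this moves the shift from \<open>F\<close> to the
    slab.\<close>
  also have "\<dots> = (\<integral>\<^sup>+\<alpha>. \<integral>\<^sup>+x. indicator S (x - \<alpha> *\<^sub>R \<nu>) * F x \<partial>lborel \<partial>lborel)"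
  proof (rule nn_integral_cong)
    fix \<alpha> :: real
    have "(\<integral>\<^sup>+x. indicator S (x - \<alpha> *\<^sub>R \<nu>) * F x \<partial>lborel)
        = (\<integral>\<^sup>+x. indicator S (x - \<alpha> *\<^sub>R \<nu>) * F x \<partial>distr lborel borel ((+) (\<alpha> *\<^sub>R \<nu>)))"
      by (simp add: lborel_distr_plus)
    also have "\<dots> = (\<integral>\<^sup>+x. indicator S x * F (x + \<alpha> *\<^sub>R \<nu>) \<partial>lborel)"
      by (subst nn_integral_distr) (simp_all add: add.commute)
    finally show "(\<integral>\<^sup>+x. indicator S x * F (x + \<alpha> *\<^sub>R \<nu>) \<partial>lborel)
        = (\<integral>\<^sup>+x. indicator S (x - \<alpha> *\<^sub>R \<nu>) * F x \<partial>lborel)" ..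
  qed
  also have "\<dots> = (\<integral>\<^sup>+x. \<integral>\<^sup>+\<alpha>. indicator S (x - \<alpha> *\<^sub>R \<nu>) * F x \<partial>lborel \<partial>lborel)"
    by (rule lborel_pair.Fubini') measurable
  also have "\<dots> = (\<integral>\<^sup>+x. F x \<partial>lborel)"
    by (simp add: nn_integral_multc len)
  finally show ?thesis unfolding S_def ..
qed

text \<open>Enclose the exceptional set in a Borel null set \<open>N\<close> and apply the slab
  formula to its indicator: the integral over the slab of the lengths of \<open>N\<close> on lines
  vanishes, so almost every such length is 0.\<close>

lemma AE_slab:
  fixes \<nu> :: "'a::euclidean_space"
  assumes ae: "AE x in lborel. P x" and \<nu>: "norm \<nu> = 1"
  shows "AE x in lborel. 0 \<le> x \<bullet> \<nu> \<and> x \<bullet> \<nu> < 1 \<longrightarrow> (AE \<alpha> in lborel. P (x + \<alpha> *\<^sub>R \<nu>))"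
proof -
  obtain N where N: "{x. \<not> P x} \<subseteq> N" "emeasure lborel N = 0" and [measurable]: "N \<in> sets borel"
    using AE_E[OF ae] by auto
  have "(\<integral>\<^sup>+x. indicator {x. 0 \<le> x \<bullet> \<nu> \<and> x \<bullet> \<nu> < 1} x
        * (\<integral>\<^sup>+\<alpha>. indicator N (x + \<alpha> *\<^sub>R \<nu>) \<partial>lborel) \<partial>lborel) = 0"
    using N by (subst nn_integral_slab[symmetric, OF _ \<nu>]) auto
  then have "AE x in lborel. indicator {x. 0 \<le> x \<bullet> \<nu> \<and> x \<bullet> \<nu> < 1} x
        * (\<integral>\<^sup>+\<alpha>. indicator N (x + \<alpha> *\<^sub>R \<nu>) \<partial>lborel) = (0 :: ennreal)"
    by (subst (asm) nn_integral_0_iff_AE) auto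
  then show ?thesis
  proof eventually_elim
    case (elim x)
    show ?case
    proof
      assume "0 \<le> x \<bullet> \<nu> \<and> x \<bullet> \<nu> < 1"
      with elim have "(\<integral>\<^sup>+\<alpha>. indicator N (x + \<alpha> *\<^sub>R \<nu>) \<partial>lborel) = 0"
        by simp
      then have "AE \<alpha> in lborel. indicator N (x + \<alpha> *\<^sub>R \<nu>) = (0 :: ennreal)"
        by (subst (asm) nn_integral_0_iff_AE) auto
      then show "AE \<alpha> in lborel. P (x + \<alpha> *\<^sub>R \<nu>)"
        by eventually_elim (use N(1) in \<open>auto simp: indicator_eq_0_iff\<close>)
    qed
  qed
qed

section \<open>Reduction to lines orthogonal to the hyperplane\<close>

lemma sup_conv_ge_min:
  assumes lam: "0 < lam" "lam < 1"
  shows "min (f x) (g y) \<le> sup_conv p lam f g ((1 - lam) *\<^sub>R x + lam *\<^sub>R y)"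
proof -
  have "min (f x) (g y) \<le> p_mean p (f x) (g y) lam"
    by (rule p_mean_ge_min[OF lam])
  also have "\<dots> \<le> sup_conv p lam f g ((1 - lam) *\<^sub>R x + lam *\<^sub>R y)"
    unfolding sup_conv_def by (rule SUP_upper2[of "(x, y)"]) auto
  finally show ?thesis .
qed

text \<open>The hypothesis on projections concerns base points in \<open>H\<close>, whereas the slab
  formula uses base points off \<open>H\<close>. Moving \<open>x\<close> along \<nu> to its
  orthogonal projection \<open>h\<close> only shifts the parameter of the line and leaves the
  supremum unchanged.\<close>

lemma SUP_line_eq:
  fixes f g :: "real ^ 'n \<Rightarrow> ennreal"
  assumes H: "H \<in> hyperplanes" and \<nu>: "is_unit_normal H \<nu>" and eq: "proj H f = proj H g"
  shows "(SUP \<alpha>::real. f (x + \<alpha> *\<^sub>R \<nu>)) = (SUP \<alpha>::real. g (x + \<alpha> *\<^sub>R \<nu>))"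
proof -
  define h where "h = x - (x \<bullet> \<nu>) *\<^sub>R \<nu>"
  have \<nu>\<nu>: "\<nu> \<bullet> \<nu> = 1" using \<nu> by (simp add: is_unit_normal_def dot_square_norm)
  have "H = {x. \<nu> \<bullet> x = 0}"
  proof (rule subspace_dim_equal)
    show "subspace {x. \<nu> \<bullet> x = 0}" by (rule subspace_hyperplane)
    have "\<nu> \<noteq> 0" using \<nu>\<nu> by auto
    then show "dim {x. \<nu> \<bullet> x = 0} \<le> dim H"
      using H by (simp add: hyperplanes_def dim_hyperplane)
  qed (use H \<nu> in \<open>auto simp: hyperplanes_def is_unit_normal_def inner_commute\<close>)
  then have h: "h \<in> H"
    by (simp add: h_def inner_diff_right \<nu>\<nu> inner_commute)
  have shift: "(SUP \<alpha>::real. u (x + \<alpha> *\<^sub>R \<nu>)) = proj H u h" for u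
  proof -
    have "range (\<lambda>\<alpha>. u (h + (x \<bullet> \<nu> + \<alpha>) *\<^sub>R \<nu>)) = (\<lambda>\<alpha>. u (h + \<alpha> *\<^sub>R \<nu>)) ` range ((+) (x \<bullet> \<nu>))"
      by (simp only: image_image)
    moreover have "h + (x \<bullet> \<nu> + \<alpha>) *\<^sub>R \<nu> = x + \<alpha> *\<^sub>R \<nu>" for \<alpha>
      by (simp add: h_def scaleR_add_left)
    ultimately have "range (\<lambda>\<alpha>. u (x + \<alpha> *\<^sub>R \<nu>)) = range (\<lambda>\<alpha>. u (h + \<alpha> *\<^sub>R \<nu>))"
      by simp
    then show ?thesis by (simp add: proj_eq[OF H \<nu> h])
  qed
  show ?thesis unfolding shift eq ..
qed

theorem theorem4p1:
  fixes f g :: "real ^ 'n \<Rightarrow> ennreal" and p :: ereal and lam :: real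
  assumes "0 < lam" and "lam < 1"
    and "f \<in> borel_measurable lebesgue" and "g \<in> borel_measurable lebesgue"
    and "p = 0 \<Longrightarrow> (\<forall>x. f x < top) \<and> (\<forall>x. g x < top)"
    and "sup_conv p lam f g \<in> borel_measurable lebesgue"
    and "\<exists>H\<in>hyperplanes. proj H f = proj H g"
  shows "(\<integral>\<^sup>+x. sup_conv p lam f g x \<partial>lebesgue)
    \<ge> ennreal (1 - lam) * (\<integral>\<^sup>+x. f x \<partial>lebesgue) + ennreal lam * (\<integral>\<^sup>+x. g x \<partial>lebesgue)"
proof -
  define h where "h = sup_conv p lam f g"
  obtain H where H: "H \<in> hyperplanes" "proj H f = proj H g"
    using assms(7) by blast
  obtain \<nu> where \<nu>: "is_unit_normal H \<nu>"
    using ex_unit_normal[OF H(1)] by blast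
  then have \<nu>1: "norm \<nu> = 1" by (simp add: is_unit_normal_def)
  \<comment> \<open>The Borel versions serve Fubini only. The pointwise bound on the convolution and
    the equality of suprema may fail for them after changes on null sets, so the inequality on each
    line is proved for \<open>f\<close>, \<open>g\<close> and \<open>h\<close> themselves.\<close>
  obtain f' where f' [measurable]: "f' \<in> borel_measurable borel" and ff': "AE x in lborel. f x = f' x"
    using completion_ex_borel_measurable[OF assms(3)] by auto
  obtain g' where g' [measurable]: "g' \<in> borel_measurable borel" and gg': "AE x in lborel. g x = g' x"
    using completion_ex_borel_measurable[OF assms(4)] by auto
  obtain h' where h' [measurable]: "h' \<in> borel_measurable borel" and hh': "AE x in lborel. h x = h' x"
    using completion_ex_borel_measurable[OF assms(6)] by (auto simp: h_def)
  let ?S = "{x. 0 \<le> x \<bullet> \<nu> \<and> x \<bullet> \<nu> < 1}"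
  define I where "I u x = (\<integral>\<^sup>+\<alpha>. u (x + \<alpha> *\<^sub>R \<nu>) \<partial>lborel)" for u x
  have [measurable]: "I u \<in> borel_measurable borel" if [measurable]: "u \<in> borel_measurable borel" for u
    unfolding I_def by measurable
  have slab: "(\<integral>\<^sup>+x. u x \<partial>lebesgue) = (\<integral>\<^sup>+x. indicator ?S x * I u' x \<partial>lborel)"
    if "AE x in lborel. u x = u' x" "u' \<in> borel_measurable borel" for u u'
  proof -
    have "(\<integral>\<^sup>+x. u x \<partial>lebesgue) = (\<integral>\<^sup>+x. u' x \<partial>lborel)"
      using that(1) by (simp add: nn_integral_completion cong: nn_integral_cong_AE)
    then show ?thesis
      by (simp add: nn_integral_slab[OF that(2) \<nu>1] I_def)
  qed
  \<comment> \<open>For almost every \<open>x\<close> in the slab, the original functions agree with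
    their Borel versions almost everywhere on the line through \<open>x\<close>, so the line
    inequality transfers to \<open>I f'\<close>, \<open>I g'\<close> and \<open>I h'\<close>.
    Outside the slab both sides are 0.\<close>
  have "AE x in lborel. ennreal (1 - lam) * (indicator ?S x * I f' x)
      + ennreal lam * (indicator ?S x * I g' x) \<le> indicator ?S x * I h' x"
    using AE_slab[OF ff' \<nu>1] AE_slab[OF gg' \<nu>1] AE_slab[OF hh' \<nu>1]
  proof eventually_elim
    case (elim x)
    show ?case
    proof (cases "x \<in> ?S")
      case True
      have fibre: "(\<lambda>\<alpha>. u (x + \<alpha> *\<^sub>R \<nu>)) \<in> borel_measurable lebesgue"
          "I u' x = (\<integral>\<^sup>+\<alpha>. u (x + \<alpha> *\<^sub>R \<nu>) \<partial>lebesgue)"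
        if [measurable]: "u' \<in> borel_measurable borel"
          and ae: "AE \<alpha> in lborel. u (x + \<alpha> *\<^sub>R \<nu>) = u' (x + \<alpha> *\<^sub>R \<nu>)" for u u'
      proof -
        show "(\<lambda>\<alpha>. u (x + \<alpha> *\<^sub>R \<nu>)) \<in> borel_measurable lebesgue"
          by (rule borel_measurable_completion_AE[OF _ ae]) measurable
        show "I u' x = (\<integral>\<^sup>+\<alpha>. u (x + \<alpha> *\<^sub>R \<nu>) \<partial>lebesgue)"
          using ae by (auto simp: I_def nn_integral_completion intro!: nn_integral_cong_AE)
      qed
      have "min (f (x + a *\<^sub>R \<nu>)) (g (x + b *\<^sub>R \<nu>)) \<le> h (x + ((1 - lam) * a + lam * b) *\<^sub>R \<nu>)" for a b
      proof -
        \<comment> \<open>The weights sum to 1, so combining two points of one line stays on that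
          line and combines their parameters.\<close>
        have "(1 - lam) *\<^sub>R (x + a *\<^sub>R \<nu>) + lam *\<^sub>R (x + b *\<^sub>R \<nu>) = x + ((1 - lam) * a + lam * b) *\<^sub>R \<nu>"
          by (simp add: algebra_simps)
        then show ?thesis
          unfolding h_def using sup_conv_ge_min[OF assms(1,2)] by metis
      qed
      then show ?thesis
        using True elim
          min_convolution_real[OF assms(1,2) fibre(1)[OF f'] fibre(1)[OF g'] fibre(1)[OF h']
            SUP_line_eq[OF H(1) \<nu> H(2)]]
        by (simp add: fibre(2)[OF f', of f] fibre(2)[OF g', of g] fibre(2)[OF h', of h])
    qed simp
  qed
  then have "(\<integral>\<^sup>+x. ennreal (1 - lam) * (indicator ?S x * I f' x)
      + ennreal lam * (indicator ?S x * I g' x) \<partial>lborel) \<le> (\<integral>\<^sup>+x. indicator ?S x * I h' x \<partial>lborel)"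
    by (rule nn_integral_mono_AE)
  then show ?thesis
    unfolding h_def[symmetric] slab[OF ff' f'] slab[OF gg' g'] slab[OF hh' h']
    by (simp add: nn_integral_add nn_integral_cmult)
qed

end
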